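(* Let $\{G_m\}_{m\in\mathbb Z}$ be a generalized Fibonacci sequence, let $n,m$ be integers and let $k$ be a non-negative integer. The following identities hold. (i) $$\sum_{j=0}^k\sum_{s=0}^{k-j}(-1)^{n(j+s)}\binom kj\binom{k-j}sF_n^{\,j+s}\,G_{m-2nk+(n+1)j+(n-1)s}=(-1)^{nk}G_m .$$ (ii) $$\sum_{j=0}^k\sum_{s=0}^{k-j}(-1)^{n(j+s)}\binom kj\binom{k-j}sF_n^{\,j+s}\,G_{m-2nk+(n-1)j+(n+1)s}=(-1)^{nk}G_m .$$ (iii) If $n\neq 0$, then $$\sum_{j=0}^k\sum_{s=0}^{k-j}(-1)^{nj}\binom kj\binom{k-j}s\frac{G_{m-(n+1)k-(n-1)j+2s}}{F_n^{\,j}}=\frac{G_m}{F_n^{\,k}} .$$ (iv) If $n\neq 0$, then $$\sum_{j=0}^k\sum_{s=0}^{j}(-1)^{s}\binom kj\binom js\frac{G_{m+(n+1)k-2j+(n+1)s}}{F_n^{\,s}}=(-1)^{(n+1)k}\frac{G_m}{F_n^{\,k}} .$$ (v) If $n\neq 0$, then $$\sum_{j=0}^k\sum_{s=0}^{j}(-1)^{n(j+s)+s}\binom kj\binom js\frac{G_{m+2k-(n+1)j+2ns}}{F_n^{\,j}}=(-1)^kG_m .$$ (vi) If $n\neq 0$, then $$\sum_{j=0}^k\sum_{s=0}^{j}(-1)^{n(j+s)+s}\binom kj\binom js\frac{G_{m-2k-(n-1)j+2ns}}{F_n^{\,j}}=(-1)^kG_m .$$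
   Context: A generalized Fibonacci sequence $\{G_m\}$ is defined by $G_m=G_{m-1}+G_{m-2}$ for $m\ge 2$, with arbitrary (say complex) initial values $G_0,G_1$. The case $G_0=0$, $G_1=1$ is the Fibonacci sequence $\{F_m\}$. Extension to negative indices is by $G_{-m}=(-1)^m(F_{m+1}G_0-F_mG_1)$ for $m\ge 1$, so that $G_m=G_{m-1}+G_{m-2}$ holds for all integers $m$ (in particular $F_{-m}=(-1)^{m+1}F_m$). Convention: $x^0=1$ for every $x$, including $x=0$. *)

theory Defs
  imports Complex_Main "HOL-Number_Theory.Fib"
begin

definition gen_fib :: "(int \<Rightarrow> complex) \<Rightarrow> bool" where
  "gen_fib G \<longleftrightarrow>
     (\<forall>m\<ge>2. G m = G (m - 1) + G (m - 2)) \<and>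
     (\<forall>m::nat. m \<ge> 1 \<longrightarrow>
        G (- int m) = (-1) ^ m * (of_nat (fib (m + 1)) * G 0 - of_nat (fib m) * G 1))"

definition fibz :: "int \<Rightarrow> complex" where
  "fibz m = (if m \<ge> 0 then of_nat (fib (nat m))
             else (-1) ^ (nat (- m) + 1) * of_nat (fib (nat (- m))))"

text \<open>The two clauses of \<^const>\<open>gen_fib\<close> amount to the recurrence on all integers,
  and \<^const>\<open>fibz\<close> is the generalized Fibonacci sequence with initial values 0 and 1.\<close>

lemma gen_fib_iff: "gen_fib G \<longleftrightarrow> (\<forall>m. G m = G (m - 1) + G (m - 2))"
proof
  assume R: "\<forall>m. G m = G (m - 1) + G (m - 2)"
  have neg: "G (- int m) = (-1) ^ m * (of_nat (fib (m + 1)) * G 0 - of_nat (fib m) * G 1)" for m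
  proof (induction m rule: fib.induct)
    case 2
    show ?case using spec[OF R, of 1] by simp
  next
    case (3 m)
    have "- int m - 1 = - int (Suc m)" "- int m - 2 = - int (Suc (Suc m))"
      by auto
    then have "G (- int m) = G (- int (Suc m)) + G (- int (Suc (Suc m)))"
      using spec[OF R, of "- int m"] by metis
    then have "G (- int (Suc (Suc m))) = G (- int m) - G (- int (Suc m))"
      by simp
    then show ?case
      unfolding 3 by (simp add: algebra_simps)
  qed simp
  show "gen_fib G"
    using R neg unfolding gen_fib_def by blast
next
  assume "gen_fib G"
  then have pos: "\<And>m. m \<ge> 2 \<Longrightarrow> G m = G (m - 1) + G (m - 2)"
    and neg: "\<And>m. m \<ge> 1 \<Longrightarrow>
      G (- int m) = (-1) ^ m * (of_nat (fib (m + 1)) * G 0 - of_nat (fib m) * G 1)"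
    unfolding gen_fib_def by blast+
  have neg': "G (- int m) = (-1) ^ m * (of_nat (fib (m + 1)) * G 0 - of_nat (fib m) * G 1)" for m
    using neg[of m] by (cases "m = 0") auto
  show "\<forall>m. G m = G (m - 1) + G (m - 2)"
  proof
    fix m :: int
    consider "m \<ge> 2" | "m = 1" | "m \<le> 0" by linarith
    then show "G m = G (m - 1) + G (m - 2)"
    proof cases
      case 2
      then show ?thesis using neg'[of 1] by simp
    next
      case 3
      define p where "p = nat (- m)"
      have eqs: "m = - int p" "m - 1 = - int (Suc p)" "m - 2 = - int (Suc (Suc p))"
        using 3 unfolding p_def by auto
      have "G (- int p) = G (- int (Suc p)) + G (- int (Suc (Suc p)))"
        unfolding neg' by (simp add: algebra_simps)
      then show ?thesis using eqs by metis
    qed (rule pos)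
  qed
qed

lemma fibz_0: "fibz 0 = 0" and fibz_1: "fibz 1 = 1"
  by (simp_all add: fibz_def)

lemma gen_fib_fibz: "gen_fib fibz"
  unfolding gen_fib_def
proof (intro conjI allI impI)
  fix m :: int assume "m \<ge> 2"
  then obtain p where "m = int p + 2"
    by (metis add.commute zle_iff_zadd)
  then have "nat m = Suc (Suc p)" "nat (m - 1) = Suc p" "nat (m - 2) = p" by auto
  with \<open>m \<ge> 2\<close> show "fibz m = fibz (m - 1) + fibz (m - 2)"
    by (simp add: fibz_def)
qed (simp add: fibz_def)

end

theory Submission
  imports Defs
begin

text \<open>
  All six identities are binomial expansions of one relation. Let \<open>x\<close> be a root of
  \<open>x\<^sup>2 = x + 1\<close>; the other root is \<open>1 - x = - 1 / x\<close>. Binet's formula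
  \<open>F\<^sub>n (x + 1 / x) = x\<^sup>n - (- 1 / x)\<^sup>n\<close>, multiplied by \<open>x\<^sup>n\<close>, becomes
  \<open>F\<^sub>n (x\<^bsup>n+1\<^esup> + x\<^bsup>n-1\<^esup>) = x\<^bsup>2n\<^esup> - (-1)\<^sup>n\<close>
  (lemma \<open>fibz_char_root\<close>).

  This is a linear relation between the four monomials \<open>x\<^bsup>n+1\<^esup>\<close>, \<open>x\<^bsup>n-1\<^esup>\<close>,
  \<open>x\<^bsup>2n\<^esup>\<close> and \<open>1\<close>. Dividing it by one of its terms gives \<open>1 + u + v = w\<close> with multiples
  \<open>u\<close>, \<open>v\<close>, \<open>w\<close> of powers of \<open>x\<close>, and the \<open>k\<close>-th power of this, expanded by the binomial
  theorem twice, is a double sum of powers of \<open>x\<close> that equals a single one. If \<open>1\<close>, \<open>u\<close>,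
  \<open>v\<close> are treated symmetrically, the inner sum ends at \<open>k - j\<close>, as in the first three
  identities; grouping as \<open>1 + u (1 + v / u)\<close> makes it end at \<open>j\<close>, as in the last three.

  Such an identity between powers of \<open>x\<close>, if it holds for both roots, holds with \<open>G\<^sub>i\<close> in place
  of \<open>x\<^sup>i\<close>, because every generalized Fibonacci sequence is a linear combination of the powers
  of the two roots (lemma \<open>gen_fib_binet\<close>). The lemmas \<open>gen_fib_trinomial\<close> and
  \<open>gen_fib_nested_binomial\<close> perform this passage once for each of the two groupings.
\<close>

section \<open>Sequences of powers and Binet's formula\<close>

definition char_root :: "complex \<Rightarrow> bool" where
  "char_root x \<longleftrightarrow> x\<^sup>2 = x + 1"

lemma char_root_nonzero: "char_root x \<Longrightarrow> x \<noteq> 0"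
  by (auto simp: char_root_def)

lemma char_root_conjugate:
  assumes "char_root x"
  shows "char_root (1 - x)" and "x * (1 - x) = -1" and "x \<noteq> 1 - x"
proof -
  show "char_root (1 - x)" and prod: "x * (1 - x) = -1"
    using assms by (simp_all add: char_root_def power2_eq_square algebra_simps)
  have "(x - (1 - x))\<^sup>2 = 4 * (x\<^sup>2 - x) + 1"
    by (simp add: power2_eq_square algebra_simps)
  also have "\<dots> = 5"
    using assms by (simp add: char_root_def)
  finally show "x \<noteq> 1 - x" by auto
qed

lemma ex_char_root: "\<exists>x. char_root x"
proof
  have "(csqrt 5)\<^sup>2 = 5" by (rule power2_csqrt)
  then show "char_root ((1 + csqrt 5) / 2)"
    by (simp add: char_root_def power2_eq_square field_simps)
qed

lemma gen_fib_power_int: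
  assumes "char_root x"
  shows "gen_fib (\<lambda>m. x powi m)"
  unfolding gen_fib_iff
proof
  fix m :: int
  have "x powi m = x powi (m - 2) * x\<^sup>2"
    using power_int_add[of x "m - 2" 2] char_root_nonzero[OF assms] by simp
  also have "\<dots> = x powi (m - 2) * x + x powi (m - 2)"
    using assms by (simp add: char_root_def algebra_simps)
  also have "x powi (m - 2) * x = x powi (m - 1)"
    using power_int_add[of x "m - 2" 1] char_root_nonzero[OF assms] by simp
  finally show "x powi m = x powi (m - 1) + x powi (m - 2)" .
qed

lemma gen_fib_linear_combination:
  assumes "gen_fib G" and "gen_fib H"
  shows "gen_fib (\<lambda>m. a * G m + b * H m)"
  unfolding gen_fib_iff
proof
  fix m :: int
  have "G m = G (m - 1) + G (m - 2)" "H m = H (m - 1) + H (m - 2)"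
    using assms unfolding gen_fib_iff by blast+
  then show "a * G m + b * H m = a * G (m - 1) + b * H (m - 1) + (a * G (m - 2) + b * H (m - 2))"
    by (simp add: algebra_simps)
qed

lemma gen_fib_eqI:
  assumes "gen_fib G" and "gen_fib H" and "G 0 = H 0" and "G 1 = H 1"
  shows "G m = H m"
proof -
  have rec: "G i = G (i - 1) + G (i - 2)" "H i = H (i - 1) + H (i - 2)" for i
    using assms(1,2) unfolding gen_fib_iff by blast+
  have "G m = H m \<and> G (m + 1) = H (m + 1)"
  proof (induction m rule: int_induct[where k = 0])
    case base
    show ?case using assms(3,4) by simp
  next
    case (step1 i)
    then show ?case using rec[of "i + 2"] by (simp add: algebra_simps)
  next
    case (step2 i)
    have "G (i - 1) = G (i + 1) - G i" "H (i - 1) = H (i + 1) - H i"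
      using rec[of "i + 1"] by simp_all
    with step2 show ?case by simp
  qed
  then show ?thesis ..
qed

lemma gen_fib_binet:
  assumes "gen_fib G"
  obtains a b x y where "char_root x" and "char_root y"
    and "\<And>m. G m = a * x powi m + b * y powi m"
proof -
  obtain x where x: "char_root x" using ex_char_root ..
  define y where "y = 1 - x"
  have y: "char_root y" and ne: "x - y \<noteq> 0"
    using char_root_conjugate[OF x] by (simp_all add: y_def)
  (* Cramer's rule for the initial conditions a + b = G 0 and a x + b y = G 1. *)
  define a where "a = (G 1 - y * G 0) / (x - y)"
  define b where "b = (x * G 0 - G 1) / (x - y)"
  have init: "a + b = G 0" "a * x + b * y = G 1"
    using ne by (simp_all add: a_def b_def divide_simps) (simp_all add: algebra_simps)
  have "gen_fib (\<lambda>m. a * x powi m + b * y powi m)"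
    by (intro gen_fib_linear_combination gen_fib_power_int x y)
  then have "G m = a * x powi m + b * y powi m" for m
    by (rule gen_fib_eqI[OF assms]) (simp_all add: init)
  with x y show ?thesis by (rule that)
qed

text \<open>Both sides of \<open>F\<^sub>n (x - y) = x\<^sup>n - y\<^sup>n\<close>, where \<open>y = 1 - x\<close>, are generalized Fibonacci
  sequences in \<open>n\<close> that agree at 0 and 1. Multiplying by \<open>x\<^sup>n\<^sup>+\<^sup>1\<close> and using \<open>x y = -1\<close>
  removes \<open>y\<close>.\<close>

lemma fibz_char_root:
  assumes "char_root x"
  shows "fibz n * (x\<^sup>2 + 1) * x powi n = x * ((x powi n)\<^sup>2 - (-1) powi n)"
proof -
  define y where "y = 1 - x"
  have y: "char_root y" and xy: "x * y = -1"
    using char_root_conjugate[OF assms] by (simp_all add: y_def)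
  have "gen_fib (\<lambda>m. (x - y) * fibz m + 0 * fibz m)"
    by (intro gen_fib_linear_combination gen_fib_fibz)
  moreover have "gen_fib (\<lambda>m. 1 * x powi m + (-1) * y powi m)"
    by (intro gen_fib_linear_combination gen_fib_power_int assms y)
  ultimately have "(x - y) * fibz n + 0 * fibz n = 1 * x powi n + (-1) * y powi n"
    by (rule gen_fib_eqI) (simp_all add: fibz_0 fibz_1)
  then have binet: "fibz n * (x - y) = x powi n - y powi n"
    by (simp add: mult.commute)
  have "x powi n * y powi n = (-1) powi n"
    using xy by (simp flip: power_int_mult_distrib)
  then have prod: "(x powi n - y powi n) * x powi n = (x powi n)\<^sup>2 - (-1) powi n"
    by (simp add: power2_eq_square algebra_simps)
  have "x\<^sup>2 + 1 = x * (x - y)"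
    using xy by (simp add: power2_eq_square algebra_simps)
  then have "fibz n * (x\<^sup>2 + 1) * x powi n = x * ((fibz n * (x - y)) * x powi n)"
    by (simp only: mult_ac)
  also have "\<dots> = x * ((x powi n)\<^sup>2 - (-1) powi n)"
    by (simp only: binet prod)
  finally show ?thesis .
qed

lemma fibz_nonzero:
  assumes "n \<noteq> 0"
  shows "fibz n \<noteq> 0"
proof -
  have "fib (nat \<bar>n\<bar>) > 0"
    using assms by (intro fib_neq_0_nat) simp
  then show ?thesis
    by (cases "n \<ge> 0") (simp_all add: fibz_def)
qed

section \<open>From identities between powers to identities between sequences\<close>

text \<open>Both sides are linear in \<open>G\<close>, and by Binet's formula the sequences of powers of the
  roots span all generalized Fibonacci sequences.\<close>

lemma gen_fib_sum_transfer:
  fixes c :: "nat \<Rightarrow> nat \<Rightarrow> complex" and e :: "nat \<Rightarrow> nat \<Rightarrow> int"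
  assumes "gen_fib G"
    and root: "\<And>x. char_root x \<Longrightarrow>
      (\<Sum>j\<in>J. \<Sum>s\<in>S j. c j s * x powi (e j s)) = d * x powi m"
  shows "(\<Sum>j\<in>J. \<Sum>s\<in>S j. c j s * G (e j s)) = d * G m"
proof -
  obtain a b x y where x: "char_root x" and y: "char_root y"
    and G: "\<And>m. G m = a * x powi m + b * y powi m"
    using gen_fib_binet[OF assms(1)] by metis
  have "(\<Sum>j\<in>J. \<Sum>s\<in>S j. c j s * G (e j s))
      = a * (\<Sum>j\<in>J. \<Sum>s\<in>S j. c j s * x powi (e j s))
        + b * (\<Sum>j\<in>J. \<Sum>s\<in>S j. c j s * y powi (e j s))"
    by (simp add: G sum_distrib_left sum.distrib algebra_simps)
  also have "\<dots> = d * G m"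
    unfolding root[OF x] root[OF y] by (simp add: G algebra_simps)
  finally show ?thesis .
qed

lemma trinomial_sum:
  fixes u v :: "'a::comm_ring_1"
  shows "(\<Sum>j=0..k. \<Sum>s=0..k - j. of_nat (k choose j) * of_nat ((k - j) choose s) * u ^ j * v ^ s)
    = (1 + u + v) ^ k"
proof -
  have "(1 + u + v) ^ k = (u + (v + 1)) ^ k"
    by (simp add: algebra_simps)
  also have "\<dots> = (\<Sum>j=0..k. of_nat (k choose j) * u ^ j * (v + 1) ^ (k - j))"
    by (simp add: binomial_ring atMost_atLeast0)
  also have "\<dots> = (\<Sum>j=0..k. \<Sum>s=0..k - j.
      of_nat (k choose j) * of_nat ((k - j) choose s) * u ^ j * v ^ s)"
    by (simp add: binomial_ring[of v] atMost_atLeast0 sum_distrib_left mult_ac)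
  finally show ?thesis ..
qed

lemma nested_binomial_sum:
  fixes u v :: "'a::comm_ring_1"
  shows "(\<Sum>j=0..k. \<Sum>s=0..j. of_nat (k choose j) * of_nat (j choose s) * u ^ j * v ^ s)
    = (1 + u * (1 + v)) ^ k"
proof -
  have "(1 + u * (1 + v)) ^ k = (u * (v + 1) + 1) ^ k"
    by (simp add: algebra_simps)
  also have "\<dots> = (\<Sum>j=0..k. of_nat (k choose j) * (u ^ j * (v + 1) ^ j))"
    by (simp add: binomial_ring[of "u * (v + 1)"] atMost_atLeast0 power_mult_distrib)
  also have "\<dots> = (\<Sum>j=0..k. \<Sum>s=0..j.
      of_nat (k choose j) * of_nat (j choose s) * u ^ j * v ^ s)"
    by (simp add: binomial_ring[of v] atMost_atLeast0 sum_distrib_left mult_ac)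
  finally show ?thesis ..
qed

lemma power_int_add_mult_nat:
  assumes "x \<noteq> (0::complex)"
  shows "x powi (m + p * int j + q * int s) = x powi m * (x powi p) ^ j * (x powi q) ^ s"
  using assms by (simp add: power_int_add power_int_mult)

text \<open>The exponents on the left are shifted down by \<open>r k\<close> so that the right-hand side, the \<open>k\<close>-th
  power of \<open>c x\<^sup>r\<close>, is left with the index \<open>m\<close>. The same holds for
  \<open>gen_fib_nested_binomial\<close>.\<close>

lemma gen_fib_trinomial:
  assumes "gen_fib G"
    and root: "\<And>x. char_root x \<Longrightarrow> 1 + a * x powi p + b * x powi q = c * x powi r"
  shows "(\<Sum>j=0..k. \<Sum>s=0..k - j. of_nat (k choose j) * of_nat ((k - j) choose s) * a ^ j * b ^ s
      * G (m - r * int k + p * int j + q * int s)) = c ^ k * G m"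
proof (rule gen_fib_sum_transfer[OF assms(1)])
  fix x assume x: "char_root x"
  note nz = char_root_nonzero[OF x]
  have "(\<Sum>j=0..k. \<Sum>s=0..k - j. of_nat (k choose j) * of_nat ((k - j) choose s) * a ^ j * b ^ s
      * x powi (m - r * int k + p * int j + q * int s))
    = x powi (m - r * int k) * (\<Sum>j=0..k. \<Sum>s=0..k - j.
        of_nat (k choose j) * of_nat ((k - j) choose s) * (a * x powi p) ^ j * (b * x powi q) ^ s)"
    by (simp only: power_int_add_mult_nat[OF nz] power_mult_distrib sum_distrib_left mult_ac)
  also have "\<dots> = x powi (m - r * int k) * (c * x powi r) ^ k"
    by (simp only: trinomial_sum root[OF x])
  also have "\<dots> = c ^ k * x powi m"
    using nz by (simp add: power_mult_distrib power_int_diff power_int_mult)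
  finally show "(\<Sum>j=0..k. \<Sum>s=0..k - j. of_nat (k choose j) * of_nat ((k - j) choose s) * a ^ j * b ^ s
      * x powi (m - r * int k + p * int j + q * int s)) = c ^ k * x powi m" .
qed

lemma gen_fib_nested_binomial:
  assumes "gen_fib G"
    and root: "\<And>x. char_root x \<Longrightarrow> 1 + a * x powi p * (1 + b * x powi q) = c * x powi r"
  shows "(\<Sum>j=0..k. \<Sum>s=0..j. of_nat (k choose j) * of_nat (j choose s) * a ^ j * b ^ s
      * G (m - r * int k + p * int j + q * int s)) = c ^ k * G m"
proof (rule gen_fib_sum_transfer[OF assms(1)])
  fix x assume x: "char_root x"
  note nz = char_root_nonzero[OF x]
  have "(\<Sum>j=0..k. \<Sum>s=0..j. of_nat (k choose j) * of_nat (j choose s) * a ^ j * b ^ s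
      * x powi (m - r * int k + p * int j + q * int s))
    = x powi (m - r * int k) * (\<Sum>j=0..k. \<Sum>s=0..j.
        of_nat (k choose j) * of_nat (j choose s) * (a * x powi p) ^ j * (b * x powi q) ^ s)"
    by (simp only: power_int_add_mult_nat[OF nz] power_mult_distrib sum_distrib_left mult_ac)
  also have "\<dots> = x powi (m - r * int k) * (c * x powi r) ^ k"
    by (simp only: nested_binomial_sum root[OF x])
  also have "\<dots> = c ^ k * x powi m"
    using nz by (simp add: power_mult_distrib power_int_diff power_int_mult)
  finally show "(\<Sum>j=0..k. \<Sum>s=0..j. of_nat (k choose j) * of_nat (j choose s) * a ^ j * b ^ s
      * x powi (m - r * int k + p * int j + q * int s)) = c ^ k * x powi m" .
qed

section \<open>The six double sums\<close>

theorem theorem3: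
  fixes G :: "int \<Rightarrow> complex" and n m :: int and k :: nat
  assumes "gen_fib G"
  shows
    "(\<Sum>j=0..k. \<Sum>s=0..k - j.
        (-1) powi (n * int (j + s)) * of_nat (k choose j) * of_nat ((k - j) choose s)
          * fibz n ^ (j + s) * G (m - 2 * n * int k + (n + 1) * int j + (n - 1) * int s))
      = (-1) powi (n * int k) * G m
     \<and>
     (\<Sum>j=0..k. \<Sum>s=0..k - j.
        (-1) powi (n * int (j + s)) * of_nat (k choose j) * of_nat ((k - j) choose s)
          * fibz n ^ (j + s) * G (m - 2 * n * int k + (n - 1) * int j + (n + 1) * int s))
      = (-1) powi (n * int k) * G m
     \<and>
     (n \<noteq> 0 \<longrightarrow>
       (\<Sum>j=0..k. \<Sum>s=0..k - j.
          (-1) powi (n * int j) * of_nat (k choose j) * of_nat ((k - j) choose s)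
            * (G (m - (n + 1) * int k - (n - 1) * int j + 2 * int s) / fibz n ^ j))
        = G m / fibz n ^ k)
     \<and>
     (n \<noteq> 0 \<longrightarrow>
       (\<Sum>j=0..k. \<Sum>s=0..j.
          (-1) ^ s * of_nat (k choose j) * of_nat (j choose s)
            * (G (m + (n + 1) * int k - 2 * int j + (n + 1) * int s) / fibz n ^ s))
        = (-1) powi ((n + 1) * int k) * (G m / fibz n ^ k))
     \<and>
     (n \<noteq> 0 \<longrightarrow>
       (\<Sum>j=0..k. \<Sum>s=0..j.
          (-1) powi (n * int (j + s) + int s) * of_nat (k choose j) * of_nat (j choose s)
            * (G (m + 2 * int k - (n + 1) * int j + 2 * n * int s) / fibz n ^ j))
        = (-1) ^ k * G m)
     \<and>
     (n \<noteq> 0 \<longrightarrow>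
       (\<Sum>j=0..k. \<Sum>s=0..j.
          (-1) powi (n * int (j + s) + int s) * of_nat (k choose j) * of_nat (j choose s)
            * (G (m - 2 * int k - (n - 1) * int j + 2 * n * int s) / fibz n ^ j))
        = (-1) ^ k * G m)"
proof -
  define f where "f = fibz n"
  define t :: complex where "t = (-1) powi n"
  have tt: "t * t = 1"
    by (simp add: t_def flip: power_int_mult_distrib)
  have t_pow: "(-1) powi (n * int i) = t ^ i" for i
    by (simp add: t_def power_int_mult)
  have t_pow_Suc: "(-1) powi ((n + 1) * int i) = (- t) ^ i" for i
    by (simp add: t_def power_int_mult power_int_add)
  have t_pow_sign: "(-1) powi (n * int (j + s) + int s) = t ^ j * (- t) ^ s" for j s
  proof -
    have "(-1) powi (n * int (j + s) + int s) = t ^ (j + s) * (-1) ^ s"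
      by (simp add: power_int_add t_pow del: of_nat_add)
    also have "\<dots> = t ^ j * (- t) ^ s"
      by (simp add: power_add power_minus[of t] mult_ac)
    finally show ?thesis .
  qed
  have key: "f * (x\<^sup>2 + 1) * x powi n = x * ((x powi n)\<^sup>2 - t)" and nz: "x \<noteq> 0" "x powi n \<noteq> 0"
    and shifts: "x powi (n + 1) = x powi n * x" "x powi (n - 1) = x powi n / x"
      "x powi (2 * n) = (x powi n)\<^sup>2"
      "x powi (- (n + 1)) = inverse (x powi n * x)" "x powi (- (n - 1)) = x / x powi n"
      "x powi 2 = x\<^sup>2" "x powi (-2) = inverse (x\<^sup>2)"
    if x: "char_root x" for x
  proof -
    note x_nz = char_root_nonzero[OF x]
    show "f * (x\<^sup>2 + 1) * x powi n = x * ((x powi n)\<^sup>2 - t)"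
      using fibz_char_root[OF x] by (simp add: f_def t_def)
    show "x \<noteq> 0" "x powi n \<noteq> 0" using x_nz by simp_all
    show "x powi (n + 1) = x powi n * x" "x powi (n - 1) = x powi n / x"
      using x_nz by (simp_all add: power_int_add power_int_diff)
    then show "x powi (- (n + 1)) = inverse (x powi n * x)" "x powi (- (n - 1)) = x / x powi n"
      unfolding power_int_minus by simp_all
    show "x powi (2 * n) = (x powi n)\<^sup>2"
      using power_int_mult[of x n 2] by (simp add: mult.commute)
    show "x powi 2 = x\<^sup>2" "x powi (-2) = inverse (x\<^sup>2)"
      by (simp_all add: power_int_minus)
  qed
  have f_nz: "f \<noteq> 0" if "n \<noteq> 0"
    using fibz_nonzero[OF that] by (simp add: f_def)

  (* The relation F_n (x^(n+1) + x^(n-1)) = x^(2n) - t, divided by t = 1 / t. The two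
     terms with F_n may come in either order, whence the first two identities. *)
  have root1: "1 + t * f * x powi (n + 1) + t * f * x powi (n - 1) = t * x powi (2 * n)"
    if x: "char_root x" for x
  proof -
    define X where "X = x powi n"
    note k = key[OF x, folded X_def]
    have "(1 + t * f * (X * x) + t * f * (X / x)) * x = x + t * (f * (x\<^sup>2 + 1) * X)"
      using nz[OF x] by (simp add: field_simps power2_eq_square)
    also have "\<dots> = t * X\<^sup>2 * x"
      unfolding k using tt by (simp add: algebra_simps)
    finally show ?thesis
      unfolding shifts[OF x] X_def[symmetric] using nz[OF x] by simp
  qed
  have id1: "(\<Sum>j=0..k. \<Sum>s=0..k - j. of_nat (k choose j) * of_nat ((k - j) choose s)
      * (t * f) ^ j * (t * f) ^ s
      * G (m - 2 * n * int k + (n + 1) * int j + (n - 1) * int s)) = t ^ k * G m"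
    by (rule gen_fib_trinomial[OF assms root1])
  have id2: "(\<Sum>j=0..k. \<Sum>s=0..k - j. of_nat (k choose j) * of_nat ((k - j) choose s)
      * (t * f) ^ j * (t * f) ^ s
      * G (m - 2 * n * int k + (n - 1) * int j + (n + 1) * int s)) = t ^ k * G m"
    by (rule gen_fib_trinomial[OF assms]) (use root1 in \<open>simp add: add_ac\<close>)
  (* Division by F_n x^(n-1) makes x^2 one of the three summands on the left. *)
  have id3: "(\<Sum>j=0..k. \<Sum>s=0..k - j. of_nat (k choose j) * of_nat ((k - j) choose s)
      * (t / f) ^ j * 1 ^ s
      * G (m - (n + 1) * int k + (- (n - 1)) * int j + 2 * int s)) = (1 / f) ^ k * G m"
    if n: "n \<noteq> 0"
  proof (rule gen_fib_trinomial[OF assms])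
    fix x assume x: "char_root x"
    define X where "X = x powi n"
    note k = key[OF x, folded X_def] and nz' = nz[OF x, folded X_def] f_nz[OF n]
    have "1 + t / f * (x / X) + 1 * x\<^sup>2 = (f * (x\<^sup>2 + 1) * X + t * x) / (f * X)"
      using nz' by (simp add: field_simps)
    also have "\<dots> = 1 / f * (X * x)"
      unfolding k using nz' by (simp add: field_simps power2_eq_square)
    finally show "1 + t / f * x powi (- (n - 1)) + 1 * x powi 2 = 1 / f * x powi (n + 1)"
      unfolding shifts[OF x] X_def[symmetric] .
  qed
  (* Division by F_n x^(n+1), with x^(2n) and F_n x^(n-1) grouped together. *)
  have id4: "(\<Sum>j=0..k. \<Sum>s=0..j. of_nat (k choose j) * of_nat (j choose s)
      * 1 ^ j * (- 1 / f) ^ s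
      * G (m - (- (n + 1)) * int k + (- 2) * int j + (n + 1) * int s)) = (- t / f) ^ k * G m"
    if n: "n \<noteq> 0"
  proof (rule gen_fib_nested_binomial[OF assms])
    fix x assume x: "char_root x"
    define X where "X = x powi n"
    note k = key[OF x, folded X_def] and nz' = nz[OF x, folded X_def] f_nz[OF n]
    have "1 + 1 * inverse (x\<^sup>2) * (1 + - 1 / f * (X * x))
        = (f * (x\<^sup>2 + 1) * X - x * X\<^sup>2) / (f * X * x\<^sup>2)"
      using nz' by (simp add: field_simps power2_eq_square)
    also have "\<dots> = - t / f * inverse (X * x)"
      unfolding k using nz' by (simp add: field_simps power2_eq_square)
    finally show "1 + 1 * x powi (- 2) * (1 + - 1 / f * x powi (n + 1)) = - t / f * x powi (- (n + 1))"
      unfolding shifts[OF x] X_def[symmetric] .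
  qed
  (* The same division, but with x^(2n) and t grouped together. *)
  have id5: "(\<Sum>j=0..k. \<Sum>s=0..j. of_nat (k choose j) * of_nat (j choose s)
      * (t / f) ^ j * (- t) ^ s
      * G (m - (- 2) * int k + (- (n + 1)) * int j + (2 * n) * int s)) = (- 1) ^ k * G m"
    if n: "n \<noteq> 0"
  proof (rule gen_fib_nested_binomial[OF assms])
    fix x assume x: "char_root x"
    define X where "X = x powi n"
    have eq: "t * (1 - t * X\<^sup>2) = t - X\<^sup>2"
      using tt by (simp add: algebra_simps)
    note k = key[OF x, folded X_def] and nz' = nz[OF x, folded X_def] f_nz[OF n]
    have "1 + t / f * inverse (X * x) * (1 + - t * X\<^sup>2) = 1 + t * (1 - t * X\<^sup>2) / (f * X * x)"
      by (simp add: divide_inverse mult_ac)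
    also have "\<dots> = (f * (x\<^sup>2 + 1) * X - f * X + x * (t - X\<^sup>2)) / (f * X * x\<^sup>2)"
      unfolding eq using nz' by (simp add: field_simps power2_eq_square)
    also have "\<dots> = - 1 * inverse (x\<^sup>2)"
      unfolding k using nz' by (simp add: field_simps)
    finally show "1 + t / f * x powi (- (n + 1)) * (1 + - t * x powi (2 * n)) = - 1 * x powi (- 2)"
      unfolding shifts[OF x] X_def[symmetric] .
  qed
  (* Now the division is by F_n x^(n-1). *)
  have id6: "(\<Sum>j=0..k. \<Sum>s=0..j. of_nat (k choose j) * of_nat (j choose s)
      * (t / f) ^ j * (- t) ^ s
      * G (m - 2 * int k + (- (n - 1)) * int j + (2 * n) * int s)) = (- 1) ^ k * G m"
    if n: "n \<noteq> 0"
  proof (rule gen_fib_nested_binomial[OF assms])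
    fix x assume x: "char_root x"
    define X where "X = x powi n"
    have eq: "t * (1 - t * X\<^sup>2) = t - X\<^sup>2"
      using tt by (simp add: algebra_simps)
    note k = key[OF x, folded X_def] and nz' = nz[OF x, folded X_def] f_nz[OF n]
    have "1 + t / f * (x / X) * (1 + - t * X\<^sup>2) = 1 + x * (t * (1 - t * X\<^sup>2)) / (f * X)"
      by (simp add: divide_inverse mult_ac)
    also have "\<dots> = (f * (x\<^sup>2 + 1) * X - f * x\<^sup>2 * X + x * (t - X\<^sup>2)) / (f * X)"
      unfolding eq using nz' by (simp add: field_simps)
    also have "\<dots> = - 1 * x\<^sup>2"
      unfolding k using nz' by (simp add: field_simps)
    finally show "1 + t / f * x powi (- (n - 1)) * (1 + - t * x powi (2 * n)) = - 1 * x powi 2"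
      unfolding shifts[OF x] X_def[symmetric] .
  qed

  have neg_index: "i - (- p) * j = i + p * j" "i + (- p) * j = i - p * j" for i p j :: int
    by simp_all
  show ?thesis
    unfolding t_pow t_pow_Suc t_pow_sign f_def[symmetric]
  proof (intro conjI impI, goal_cases)
    case 1
    show ?case using id1 by (simp only: power_add power_mult_distrib mult_ac)
  next
    case 2
    show ?case using id2 by (simp only: power_add power_mult_distrib mult_ac)
  next
    case 3
    show ?case using id3[OF \<open>n \<noteq> 0\<close>, unfolded neg_index power_divide]
      by (simp add: mult_ac)
  next
    case 4
    show ?case using id4[OF \<open>n \<noteq> 0\<close>, unfolded neg_index power_divide]
      by (simp add: mult_ac)
  next
    case 5
    show ?case using id5[OF \<open>n \<noteq> 0\<close>, unfolded neg_index power_divide]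
      by (simp add: mult_ac)
  next
    case 6
    show ?case using id6[OF \<open>n \<noteq> 0\<close>, unfolded neg_index power_divide]
      by (simp add: mult_ac)
  qed
qed

end
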